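(* Let $f:\mathfrak S_n\to\mathbb C$ be a function. The following conditions are equivalent: (1) The immanant $\operatorname{Imm}_f=\sum_{\sigma\in\mathfrak S_n}f(\sigma)x_\sigma$ lies in $P_n^{\%}$, the $\mathbb C$-vector space spanned by the \%-immanants of degree $n$. (2) $f(w)=-f(w')$ for all $w,w'\in\mathfrak S_n$ that are $1324$-adjacent.
   Context: $\mathfrak S_n$ is the symmetric group on $[n]=\{1,\dots,n\}$; $x_{i,j}$ ($1\le i,j\le n$) are commuting variables, and $x_\sigma=\prod_{i=1}^n x_{i,\sigma(i)}$ for $\sigma\in\mathfrak S_n$. \%-immanants. A skew shape $\lambda/\mu$ (in the $n\times n$ square) is given by non-increasing sequences of non-negative integers $\lambda=(\lambda_1,\dots,\lambda_n)$, $\mu=(\mu_1,\dots,\mu_n)$ with $\mu_i\le\lambda_i\le n$. A permutation $\sigma\in\mathfrak S_n$ lies in $\lambda/\mu$ if $\mu_i<\sigma(i)\le\lambda_i$ for all $1\le i\le n$. The \%-immanant (of degree $n$) of $\lambda/\mu$ is $\operatorname{Imm}^{\%}_{\lambda/\mu}=\sum_{\sigma}\operatorname{sgn}(\sigma)x_\sigma$, summed over all $\sigma\in\mathfrak S_n$ lying in $\lambda/\mu$. $1324$-adjacency. Two permutations $w,w'\in\mathfrak S_n$ are $1324$-adjacent if $w(i)=w'(i)$ for all $i$ except two values $a<b$, and there exist $c,d$ with $c<a<b<d$ such that either [$w(c)<w(a)<w(b)<w(d)$ and $w'(c)<w'(b)<w'(a)<w'(d)$], or the same holds with $w$ and $w'$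 exchanged. *)

theory Defs
  imports
    Complex_Main
    "HOL-Library.Poly_Mapping"
    "HOL-Combinatorics.Permutations"
begin

text \<open>
  Polynomials over the complex numbers in commuting variables indexed by pairs of naturals: a
  monomial is a finitely supported exponent function, a polynomial a finitely supported
  coefficient function on monomials.  Only the variables with both indices in \<open>{1..n}\<close> are used.
\<close>

type_synonym cpoly = "((nat \<times> nat) \<Rightarrow>\<^sub>0 nat) \<Rightarrow>\<^sub>0 complex"

definition X :: "nat \<Rightarrow> nat \<Rightarrow> cpoly" where
  "X i j = Poly_Mapping.single (Poly_Mapping.single (i, j) 1) 1"

definition cscale :: "complex \<Rightarrow> cpoly \<Rightarrow> cpoly" where
  "cscale c p = Poly_Mapping.single 0 c * p"

lemma vector_space_cscale: "vector_space cscale"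
  by unfold_locales
    (simp_all add: cscale_def algebra_simps single_add mult_single flip: mult.assoc)

definition x_perm :: "nat \<Rightarrow> (nat \<Rightarrow> nat) \<Rightarrow> cpoly" where
  "x_perm n \<sigma> = (\<Prod>i\<in>{1..n}. X i (\<sigma> i))"

text \<open>
  The symmetric group on \<open>{1..n}\<close> is the set of functions \<open>\<sigma>\<close> with \<open>\<sigma> permutes {1..n}\<close>, which
  are the identity outside \<open>{1..n}\<close>.  Values of \<open>f\<close> elsewhere are irrelevant.
\<close>

definition immanant :: "nat \<Rightarrow> ((nat \<Rightarrow> nat) \<Rightarrow> complex) \<Rightarrow> cpoly" where
  "immanant n f = (\<Sum>\<sigma> | \<sigma> permutes {1..n}. cscale (f \<sigma>) (x_perm n \<sigma>))"

definition skew_shape :: "nat \<Rightarrow> (nat \<Rightarrow> nat) \<Rightarrow> (nat \<Rightarrow> nat) \<Rightarrow> bool" where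
  "skew_shape n lam mu \<longleftrightarrow>
     antimono_on {1..n} lam \<and> antimono_on {1..n} mu \<and>
     (\<forall>i\<in>{1..n}. mu i \<le> lam i \<and> lam i \<le> n)"

definition lies_in :: "nat \<Rightarrow> (nat \<Rightarrow> nat) \<Rightarrow> (nat \<Rightarrow> nat) \<Rightarrow> (nat \<Rightarrow> nat) \<Rightarrow> bool" where
  "lies_in n \<sigma> lam mu \<longleftrightarrow> (\<forall>i\<in>{1..n}. mu i < \<sigma> i \<and> \<sigma> i \<le> lam i)"

definition percent_immanant :: "nat \<Rightarrow> (nat \<Rightarrow> nat) \<Rightarrow> (nat \<Rightarrow> nat) \<Rightarrow> cpoly" where
  "percent_immanant n lam mu =
     (\<Sum>\<sigma> | \<sigma> permutes {1..n} \<and> lies_in n \<sigma> lam mu. of_int (sign \<sigma>) * x_perm n \<sigma>)"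

definition percent_space :: "nat \<Rightarrow> cpoly set" where
  "percent_space n =
     module.span cscale {percent_immanant n lam mu | lam mu. skew_shape n lam mu}"

definition adjacent_1324 :: "nat \<Rightarrow> (nat \<Rightarrow> nat) \<Rightarrow> (nat \<Rightarrow> nat) \<Rightarrow> bool" where
  "adjacent_1324 n w w' \<longleftrightarrow>
     (\<exists>a b. a < b \<and> {i \<in> {1..n}. w i \<noteq> w' i} = {a, b} \<and>
       (\<exists>c\<in>{1..n}. \<exists>d\<in>{1..n}. c < a \<and> b < d \<and>
         ((w c < w a \<and> w a < w b \<and> w b < w d \<and> w' c < w' b \<and> w' b < w' a \<and> w' a < w' d) \<or>
          (w' c < w' a \<and> w' a < w' b \<and> w' b < w' d \<and> w c < w b \<and> w b < w a \<and> w a < w d))))"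

end

theory Submission
  imports Defs
begin

text \<open>
  For \<open>v, w\<close> in the symmetric group write \<open>v \<le> w\<close> if \<open>v\<close> lies in the smallest skew shape containing
  \<open>w\<close>, that is, if every point of \<open>v\<close> has a point of \<open>w\<close> weakly to its lower left and one weakly
  to its upper right.  A skew shape contains with two points \<open>(c, k)\<close>, \<open>(d, l)\<close>, \<open>c < d\<close>, \<open>k < l\<close>,
  the whole rectangle between them, so \<open>1324\<close>-adjacent permutations lie in the same skew shapes;
  they have opposite signs, which gives one implication.

  Conversely, let \<open>v \<le> w \<le> v\<close>, let \<open>a\<close> be the first position where they differ, say \<open>v a < w a\<close>,
  and let \<open>v b = w a\<close>.  The hypothesis supplies \<open>c < a\<close> and \<open>d > b\<close> that make \<open>v\<close> adjacent to
  \<open>v \<circ> (a b)\<close>, which agrees with \<open>w\<close> up to \<open>a\<close>.  So \<open>v\<close> and \<open>w\<close> are joined by a chain of adjacent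
  permutations, and \<open>\<sigma> \<mapsto> sign \<sigma> * f \<sigma>\<close> is constant on the classes of the preorder.  Such functions
  are spanned by the indicators of the principal down-sets, by peeling off maximal classes.
\<close>

section \<open>Coefficients of immanants\<close>

text \<open>The exponent of the monomial \<open>x_perm n \<sigma>\<close>; for a permutation, read
  as a matrix, it is the permutation matrix of \<open>\<sigma>\<close>.\<close>

definition perm_monom :: "nat \<Rightarrow> (nat \<Rightarrow> nat) \<Rightarrow> (nat \<times> nat) \<Rightarrow>\<^sub>0 nat" where
  "perm_monom n \<sigma> = (\<Sum>i\<in>{1..n}. Poly_Mapping.single (i, \<sigma> i) 1)"

lemma x_perm_eq_single: "x_perm n \<sigma> = Poly_Mapping.single (perm_monom n \<sigma>) 1"
proof -
  have "(\<Prod>i\<in>A. X i (\<sigma> i)) =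
      Poly_Mapping.single (\<Sum>i\<in>A. Poly_Mapping.single (i, \<sigma> i) 1) 1" if "finite A" for A
    using that by induction (simp_all add: X_def mult_single)
  then show ?thesis by (simp add: x_perm_def perm_monom_def)
qed

lemma lookup_perm_monom:
  "Poly_Mapping.lookup (perm_monom n \<sigma>) (i, j) = (if i \<in> {1..n} \<and> \<sigma> i = j then 1 else 0)"
proof -
  have "Poly_Mapping.lookup (perm_monom n \<sigma>) (i, j) =
      (\<Sum>k\<in>{1..n}. if k = i then (if \<sigma> i = j then 1 else 0) else 0)"
    unfolding perm_monom_def lookup_sum
    by (rule sum.cong) (auto simp: lookup_single when_def)
  then show ?thesis by auto
qed

text \<open>A permutation can be read off its 0/1 matrix. Hence the summands of an immanant never
  share a monomial, and \<open>f\<close> is recovered from coefficients.\<close>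

lemma perm_monom_inject:
  assumes "\<sigma> permutes {1..n}" "\<tau> permutes {1..n}" "perm_monom n \<sigma> = perm_monom n \<tau>"
  shows "\<sigma> = \<tau>"
proof
  fix i
  show "\<sigma> i = \<tau> i"
  proof (cases "i \<in> {1..n}")
    case True
    have "Poly_Mapping.lookup (perm_monom n \<tau>) (i, \<sigma> i) = 1"
      unfolding assms(3)[symmetric] lookup_perm_monom using True by simp
    then show ?thesis unfolding lookup_perm_monom by (metis zero_neq_one)
  next
    case False
    then show ?thesis using permutes_not_in[OF assms(1)] permutes_not_in[OF assms(2)] by metis
  qed
qed

lemma immanant_eq_sum_single:
  "immanant n f = (\<Sum>\<sigma> | \<sigma> permutes {1..n}. Poly_Mapping.single (perm_monom n \<sigma>) (f \<sigma>))"
  by (simp add: immanant_def cscale_def x_perm_eq_single mult_single)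

lemma lookup_immanant:
  assumes "\<sigma> permutes {1..n}"
  shows "Poly_Mapping.lookup (immanant n f) (perm_monom n \<sigma>) = f \<sigma>"
proof -
  have "Poly_Mapping.lookup (immanant n f) (perm_monom n \<sigma>) =
      (\<Sum>\<tau> | \<tau> permutes {1..n}. if \<tau> = \<sigma> then f \<sigma> else 0)"
    unfolding immanant_eq_sum_single lookup_sum
    by (rule sum.cong) (auto simp: lookup_single when_def perm_monom_inject[OF _ assms])
  then show ?thesis using assms by (simp add: finite_permutations)
qed

lemma immanant_add: "immanant n (\<lambda>\<sigma>. f \<sigma> + g \<sigma>) = immanant n f + immanant n g"
  by (simp add: immanant_eq_sum_single single_add sum.distrib)

lemma immanant_scale: "immanant n (\<lambda>\<sigma>. c * f \<sigma>) = cscale c (immanant n f)"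
  by (simp add: immanant_eq_sum_single cscale_def sum_distrib_left mult_single)

lemma immanant_cong:
  assumes "\<And>\<sigma>. \<sigma> permutes {1..n} \<Longrightarrow> f \<sigma> = g \<sigma>"
  shows "immanant n f = immanant n g"
  using assms by (simp add: immanant_def)

lemma percent_immanant_eq_immanant:
  "percent_immanant n lam mu =
     immanant n (\<lambda>\<sigma>. if lies_in n \<sigma> lam mu then of_int (sign \<sigma>) else 0)"
proof -
  have single_if: "(if P then Poly_Mapping.single k c else 0) =
      Poly_Mapping.single k (if P then c else 0)" for P and k :: "(nat \<times> nat) \<Rightarrow>\<^sub>0 nat" and c :: complex
    by simp
  \<comment> \<open>\<open>of_int\<close> is a polynomial on the left and a complex number on the
    right; the signs 1 and -1 are checked separately.\<close>
  have "of_int (sign \<sigma>) * x_perm n \<sigma> =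
      Poly_Mapping.single (perm_monom n \<sigma>) (of_int (sign \<sigma>))" for \<sigma>
    by (cases \<sigma> rule: sign_cases) (simp_all add: x_perm_eq_single single_uminus)
  then have "percent_immanant n lam mu =
      (\<Sum>\<sigma> | \<sigma> permutes {1..n} \<and> lies_in n \<sigma> lam mu.
        Poly_Mapping.single (perm_monom n \<sigma>) (of_int (sign \<sigma>)))"
    by (simp add: percent_immanant_def)
  also have "\<dots> = (\<Sum>\<sigma> | \<sigma> permutes {1..n}. if lies_in n \<sigma> lam mu
        then Poly_Mapping.single (perm_monom n \<sigma>) (of_int (sign \<sigma>)) else 0)"
    using sum.inter_filter[of "{\<sigma>. \<sigma> permutes {1..n}}"] finite_permutations[of "{1..n}"]
    by simp
  finally show ?thesis by (simp add: single_if immanant_eq_sum_single)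
qed

interpretation cpoly: vector_space cscale
  by (rule vector_space_cscale)

lemma percent_space_zero: "0 \<in> percent_space n"
  unfolding percent_space_def by (rule cpoly.span_zero)

lemma percent_space_add: "p \<in> percent_space n \<Longrightarrow> q \<in> percent_space n \<Longrightarrow> p + q \<in> percent_space n"
  unfolding percent_space_def by (rule cpoly.span_add)

lemma percent_space_scale: "p \<in> percent_space n \<Longrightarrow> cscale c p \<in> percent_space n"
  unfolding percent_space_def by (rule cpoly.span_scale)

lemma percent_immanant_in_percent_space:
  "skew_shape n lam mu \<Longrightarrow> percent_immanant n lam mu \<in> percent_space n"
  unfolding percent_space_def by (rule cpoly.span_base) blast

section \<open>Adjacency\<close>

lemma adjacent_1324_sym:
  assumes "adjacent_1324 n v w"
  shows "adjacent_1324 n w v"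
proof -
  have "{i \<in> {1..n}. w i \<noteq> v i} = {i \<in> {1..n}. v i \<noteq> w i}" by auto
  then show ?thesis using assms unfolding adjacent_1324_def by (simp only: disj_commute)
qed

text \<open>\<open>v\<close> takes the value \<open>w a\<close> somewhere: not at \<open>a\<close>,
  and by injectivity of \<open>w\<close> not at a place of agreement, so at \<open>b\<close>. The
  same holds with \<open>a\<close> and \<open>b\<close> exchanged.\<close>

lemma permutes_differ_at_two:
  assumes v: "v permutes S" and w: "w permutes S" and ab: "{i \<in> S. v i \<noteq> w i} = {a, b}"
  shows "w = v \<circ> Transposition.transpose a b"
proof -
  have other: "w i = v i" if "i \<noteq> a" "i \<noteq> b" for i
  proof (cases "i \<in> S")
    case True
    then have "i \<notin> {i \<in> S. v i \<noteq> w i}" unfolding ab using that by simp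
    then show ?thesis using True by simp
  next
    case False
    then show ?thesis using permutes_not_in[OF v] permutes_not_in[OF w] by metis
  qed
  have "a \<in> {i \<in> S. v i \<noteq> w i}" "b \<in> {i \<in> S. v i \<noteq> w i}" unfolding ab by simp_all
  then have "v a \<noteq> w a" "v b \<noteq> w b" by simp_all
  have hit: "\<exists>x. v x = w i \<and> (x = i \<or> x = a \<or> x = b)" for i
  proof -
    obtain x where "w i = v x" using surjD[OF permutes_surj[OF v]] by blast
    moreover from this have "x = i" if "x \<noteq> a" "x \<noteq> b"
      using other[OF that] injD[OF permutes_inj[OF w], of x i] by simp
    ultimately show ?thesis by metis
  qed
  have "w a = v b" using hit[of a] \<open>v a \<noteq> w a\<close> by auto
  moreover have "w b = v a" using hit[of b] \<open>v b \<noteq> w b\<close> by auto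
  ultimately show ?thesis
    using other by (auto simp: fun_eq_iff Transposition.transpose_def)
qed

lemma sign_adjacent_1324:
  assumes "v permutes {1..n}" "w permutes {1..n}" "adjacent_1324 n v w"
  shows "sign w = - sign v"
proof -
  obtain a b where "a < b" and ne: "{i \<in> {1..n}. v i \<noteq> w i} = {a, b}"
    using assms(3) unfolding adjacent_1324_def by (elim exE conjE)
  moreover have "w = v \<circ> Transposition.transpose a b"
    by (rule permutes_differ_at_two[OF assms(1,2) ne])
  moreover have "permutation v" using assms(1) permutation_permutes by blast
  ultimately show ?thesis
    by (simp add: sign_compose permutation_swap_id sign_swap_id)
qed

lemma adjacent_1324_transpose:
  assumes v: "v permutes {1..n}" and cd: "c \<in> {1..n}" "d \<in> {1..n}"
    and order: "c < a" "a < b" "b < d" and vals: "v c < v a" "v a < v b" "v b < v d"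
  shows "adjacent_1324 n v (v \<circ> Transposition.transpose a b)"
proof -
  define u where "u = v \<circ> Transposition.transpose a b"
  have other: "u i = v i" if "i \<noteq> a" "i \<noteq> b" for i
    using that by (simp add: u_def)
  have ucd: "u c = v c" "u d = v d" using order other[of c] other[of d] by auto
  have "i = a \<or> i = b" if "v i \<noteq> u i" for i
    using that other by metis
  moreover have "a \<in> {1..n}" "b \<in> {1..n}" using cd order by auto
  moreover have ab: "u a = v b" "u b = v a" by (simp_all add: u_def)
  moreover have "v a \<noteq> u a" "v b \<noteq> u b" using ab vals by simp_all
  ultimately have "{i \<in> {1..n}. v i \<noteq> u i} = {a, b}" by blast
  moreover have "v c < v a \<and> v a < v b \<and> v b < v d \<and> u c < u b \<and> u b < u a \<and> u a < u d"
    using vals ucd ab by simp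
  ultimately show ?thesis
    unfolding adjacent_1324_def u_def[symmetric] using cd order by metis
qed

text \<open>Both bounds are non-increasing: \<open>mu i \<le> mu c < \<sigma> c \<le> k \<le>
  \<sigma> d \<le> lam d \<le> lam i\<close>.\<close>

lemma lies_in_rectangle:
  assumes "skew_shape n lam mu" "lies_in n \<sigma> lam mu"
    and "c \<in> {1..n}" "d \<in> {1..n}" "c \<le> i" "i \<le> d" "\<sigma> c \<le> k" "k \<le> \<sigma> d"
  shows "mu i < k \<and> k \<le> lam i"
proof -
  have i: "i \<in> {1..n}" using assms by auto
  have "mu i \<le> mu c" "lam d \<le> lam i"
    using assms i unfolding skew_shape_def monotone_on_def by auto
  moreover have "mu c < \<sigma> c" "\<sigma> d \<le> lam d"
    using assms unfolding lies_in_def by auto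
  ultimately show ?thesis using assms by linarith
qed

lemma lies_in_adjacent_1324:
  assumes v: "v permutes {1..n}" and w: "w permutes {1..n}" and adj: "adjacent_1324 n v w"
    and sk: "skew_shape n lam mu" and lies: "lies_in n v lam mu"
  shows "lies_in n w lam mu"
proof -
  obtain a b c d where ab: "a < b" and ne: "{i \<in> {1..n}. v i \<noteq> w i} = {a, b}"
    and cd: "c \<in> {1..n}" "d \<in> {1..n}" "c < a" "b < d"
    and vals: "(v c < v a \<and> v a < v b \<and> v b < v d \<and> w c < w b \<and> w b < w a \<and> w a < w d) \<or>
      (w c < w a \<and> w a < w b \<and> w b < w d \<and> v c < v b \<and> v b < v a \<and> v a < v d)"
    using adj unfolding adjacent_1324_def by (elim exE conjE bexE) (rule that)
  have tr: "w = v \<circ> Transposition.transpose a b"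
    by (rule permutes_differ_at_two[OF v w ne])
  have wa: "w a = v b" and wb: "w b = v a" by (simp_all add: tr)
  have "mu i < w i \<and> w i \<le> lam i" if i: "i \<in> {1..n}" for i
  proof (cases "i = a \<or> i = b")
    case True
    \<comment> \<open>In either orientation \<open>v a\<close> and \<open>v b\<close> lie between
      \<open>v c\<close> and \<open>v d\<close>, so the exchanged points stay in the rectangle
      spanned by the points at \<open>c\<close> and \<open>d\<close>.\<close>
    then show ?thesis
      using lies_in_rectangle[OF sk lies cd(1,2), of i "w i"] ab cd vals wa wb by auto
  next
    case False
    then have "w i = v i" by (simp add: tr)
    then show ?thesis using lies i unfolding lies_in_def by auto
  qed
  then show ?thesis unfolding lies_in_def by blast
qed

text \<open>The condition is linear in \<open>p\<close>, so it suffices to test one %-immanant: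
  \<open>v\<close> and \<open>w\<close> are both in its shape or both outside, and their signs are
  opposite.\<close>

lemma percent_space_imp_antisymmetric:
  assumes "p \<in> percent_space n" "v permutes {1..n}" "w permutes {1..n}" "adjacent_1324 n v w"
  shows "Poly_Mapping.lookup p (perm_monom n v) = - Poly_Mapping.lookup p (perm_monom n w)"
proof -
  have lookup_cscale: "Poly_Mapping.lookup (cscale c q) m = c * Poly_Mapping.lookup q m" for c q m
    by (simp add: cscale_def flip: mult_map_scale_conv_mult) (auto simp: Poly_Mapping.map.rep_eq when_def)
  show ?thesis
    using assms(1)[unfolded percent_space_def]
  proof (induction rule: cpoly.span_induct_alt)
    case base
    then show ?case by simp
  next
    case (step c x y)
    then obtain lam mu where x: "x = percent_immanant n lam mu" and sk: "skew_shape n lam mu"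
      by blast
    have "lies_in n v lam mu \<longleftrightarrow> lies_in n w lam mu"
      using assms lies_in_adjacent_1324 sk adjacent_1324_sym by blast
    then have "Poly_Mapping.lookup x (perm_monom n v) = - Poly_Mapping.lookup x (perm_monom n w)"
      by (simp add: x percent_immanant_eq_immanant lookup_immanant[OF assms(2)]
          lookup_immanant[OF assms(3)] sign_adjacent_1324[OF assms(2-4)])
    then show ?case using step by (simp add: lookup_add lookup_cscale)
  qed
qed

section \<open>Minimal skew shapes\<close>

text \<open>The preorder \<open>v \<le> w\<close>, expressed through points;
  \<open>minimal_skew_shape\<close> links it to shapes.\<close>

definition enclosed :: "nat \<Rightarrow> (nat \<Rightarrow> nat) \<Rightarrow> (nat \<Rightarrow> nat) \<Rightarrow> bool" where
  "enclosed n v w \<longleftrightarrow>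
     (\<forall>i\<in>{1..n}. (\<exists>j\<in>{1..i}. w j \<le> v i) \<and> (\<exists>j\<in>{i..n}. v i \<le> w j))"

lemma enclosed_refl: "enclosed n v v"
  unfolding enclosed_def by force

lemma enclosed_trans:
  assumes "enclosed n u v" "enclosed n v w"
  shows "enclosed n u w"
  unfolding enclosed_def
proof (intro ballI conjI)
  fix i assume i: "i \<in> {1..n}"
  obtain j where j: "j \<in> {1..i}" "v j \<le> u i" using assms(1) i unfolding enclosed_def by blast
  moreover obtain k where "k \<in> {1..j}" "w k \<le> v j"
    using assms(2) i j unfolding enclosed_def by fastforce
  ultimately show "\<exists>j\<in>{1..i}. w j \<le> u i" by (intro bexI[of _ k]) auto
  obtain j where j: "j \<in> {i..n}" "u i \<le> v j" using assms(1) i unfolding enclosed_def by blast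
  moreover obtain k where "k \<in> {j..n}" "v j \<le> w k"
    using assms(2) i j unfolding enclosed_def by fastforce
  ultimately show "\<exists>j\<in>{i..n}. u i \<le> w j" by (intro bexI[of _ k]) auto
qed

lemma minimal_skew_shape:
  assumes w: "w permutes {1..n}"
  obtains lam mu where "skew_shape n lam mu"
    and "\<And>v. lies_in n v lam mu \<longleftrightarrow> enclosed n v w"
proof
  \<comment> \<open>Monotonicity forces \<open>lam i\<close> to dominate all values of
    \<open>w\<close> from \<open>i\<close> on, and \<open>mu i\<close> to stay strictly below all
    values up to \<open>i\<close>, whence the \<open>- 1\<close>.\<close>
  define lam where "lam i = Max (w ` {i..n})" for i
  define mu where "mu i = Min (w ` {1..i}) - 1" for i
  have range: "w i \<in> {1..n}" if "i \<in> {1..n}" for i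
    using permutes_in_image[OF w] that by blast
  have "lam j \<le> lam i" if "i \<in> {1..n}" "j \<in> {1..n}" "i \<le> j" for i j
    unfolding lam_def using that by (intro Max_mono) auto
  moreover have "mu j \<le> mu i" if "i \<in> {1..n}" "j \<in> {1..n}" "i \<le> j" for i j
    unfolding mu_def using that by (intro diff_le_mono Min_antimono) auto
  moreover have "mu i \<le> lam i \<and> lam i \<le> n" if i: "i \<in> {1..n}" for i
  proof -
    have "Min (w ` {1..i}) \<le> w i" "w i \<le> lam i" using i unfolding lam_def by simp_all
    then have "mu i \<le> lam i" unfolding mu_def by linarith
    moreover have "lam i \<le> n" using i range unfolding lam_def by (subst Max_le_iff) auto
    ultimately show ?thesis by blast
  qed
  ultimately show "skew_shape n lam mu"
    unfolding skew_shape_def monotone_on_def by blast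
  have mu_less: "mu i < k \<longleftrightarrow> (\<exists>j\<in>{1..i}. w j \<le> k)" if i: "i \<in> {1..n}" for i k
  proof -
    \<comment> \<open>Values start at 1, so the truncated subtraction in \<open>mu\<close> is
      exact.\<close>
    have "1 \<le> Min (w ` {1..i})" using i range by (subst Min_ge_iff) auto
    then have "mu i < k \<longleftrightarrow> Min (w ` {1..i}) \<le> k" unfolding mu_def by linarith
    also have "\<dots> \<longleftrightarrow> (\<exists>j\<in>{1..i}. w j \<le> k)" using i by (subst Min_le_iff) auto
    finally show ?thesis .
  qed
  have le_lam: "k \<le> lam i \<longleftrightarrow> (\<exists>j\<in>{i..n}. k \<le> w j)" if "i \<in> {1..n}" for i k
    unfolding lam_def using that by (subst Max_ge_iff) auto
  show "lies_in n v lam mu \<longleftrightarrow> enclosed n v w" for v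
    unfolding lies_in_def enclosed_def using mu_less le_lam by blast
qed

text \<open>Adjacency preserves membership in every shape, in particular in the smallest one
  containing \<open>v\<close>.\<close>

lemma enclosed_adjacent_1324:
  assumes "v permutes {1..n}" "w permutes {1..n}" "adjacent_1324 n v w"
  shows "enclosed n w v"
proof -
  obtain lam mu where "skew_shape n lam mu"
    and "\<And>u. lies_in n u lam mu \<longleftrightarrow> enclosed n u v"
    using minimal_skew_shape[OF assms(1)] by blast
  then show ?thesis using lies_in_adjacent_1324 assms enclosed_refl by blast
qed

section \<open>Joining equivalent permutations by adjacent ones\<close>

lemma adjacent_1324_extending_prefix:
  assumes v: "v permutes {1..n}" and w: "w permutes {1..n}"
    and vw: "enclosed n v w" and wv: "enclosed n w v"
    and prefix: "\<And>i. i < a \<Longrightarrow> v i = w i" and less: "v a < w a"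
  obtains u where "u permutes {1..n}" "adjacent_1324 n v u" "\<And>i. i \<le> a \<Longrightarrow> u i = w i"
proof -
  have a: "a \<in> {1..n}"
    using less permutes_not_in[OF v, of a] permutes_not_in[OF w, of a]
    by (cases "a \<in> {1..n}") simp_all
  have injv: "inj v" and injw: "inj w" using v w permutes_inj by blast+
  obtain b where b: "v b = w a" by (metis v permutes_surj surjD)
  have "b \<noteq> a" using b less by auto
  \<comment> \<open>If \<open>b < a\<close>, then \<open>w b = v b = w a\<close>, contradicting
    injectivity.\<close>
  moreover have "\<not> b < a" using b prefix[of b] injD[OF injw, of b a] by auto
  ultimately have ab: "a < b" by simp
  have bn: "b \<in> {1..n}"
    using a b permutes_in_image[OF v] permutes_in_image[OF w] by metis
  \<comment> \<open>A point of \<open>w\<close> to the lower left of \<open>(a, v a)\<close>. As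
    \<open>v a < w a\<close>, it is not at \<open>a\<close>, so it lies in the common prefix and is
    a point of \<open>v\<close> too.\<close>
  obtain c where c: "c \<in> {1..a}" "w c \<le> v a" using vw a unfolding enclosed_def by blast
  have "c \<noteq> a" using c less by auto
  then have ca: "c < a" using c by simp
  have vc: "v c < v a"
    using prefix[OF ca] c \<open>c \<noteq> a\<close> injD[OF injv, of c a] by fastforce
  \<comment> \<open>Two moves to the upper right lead to \<open>d\<close>: from
    \<open>(b, v b)\<close> to a point of \<open>w\<close>, strictly higher because \<open>w\<close>
    takes the value \<open>v b\<close> only at \<open>a\<close>, and from there back to a point of
    \<open>v\<close>.\<close>
  obtain j where j: "j \<in> {b..n}" "v b \<le> w j" using vw bn unfolding enclosed_def by blast
  have "w j \<noteq> w a" using injD[OF injw, of j a] j ab by auto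
  then have wj: "v b < w j" using b j by simp
  obtain d where d: "d \<in> {j..n}" "w j \<le> v d"
    using wv bn j unfolding enclosed_def by fastforce
  have vd: "v b < v d" using wj d by simp
  then have "d \<noteq> b" by auto
  then have bd: "b < d" using d j by simp
  define u where "u = v \<circ> Transposition.transpose a b"
  show ?thesis
  proof
    show "u permutes {1..n}"
      unfolding u_def using a bn v by (intro permutes_compose permutes_swap_id) auto
    show "adjacent_1324 n v u"
      unfolding u_def using a bn b c d j ca ab bd vc vd less
      by (intro adjacent_1324_transpose[OF v, of c d]) auto
    show "u i = w i" if "i \<le> a" for i
      using that prefix[of i] b ab by (auto simp: u_def Transposition.transpose_def)
  qed
qed

text \<open>Downward induction on a bound \<open>a\<close> below which \<open>v\<close> and
  \<open>w\<close> agree: at \<open>Suc n\<close> they are equal, at 0 nothing is assumed. An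
  adjacent swap lengthens the common prefix without leaving the class.\<close>

lemma constant_on_enclosed_classes:
  assumes g: "\<And>v w. v permutes {1..n} \<Longrightarrow> w permutes {1..n} \<Longrightarrow> adjacent_1324 n v w \<Longrightarrow> g v = g w"
    and "v permutes {1..n}" "w permutes {1..n}" "enclosed n v w" "enclosed n w v"
  shows "g v = g w"
proof -
  have "g v = g w" if "a \<le> Suc n" "\<And>i. i < a \<Longrightarrow> v i = w i"
      "v permutes {1..n}" "w permutes {1..n}" "enclosed n v w" "enclosed n w v" for a v w
    using that
  proof (induction a arbitrary: v w rule: inc_induct)
    case base
    have "v i = w i" for i
      using base(1)[of i] permutes_not_in[OF base(2), of i] permutes_not_in[OF base(3), of i]
      by (cases "i < Suc n") auto
    then have "v = w" by blast
    then show ?case by simp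
  next
    case (step a)
    \<comment> \<open>Stated for arbitrary \<open>v\<close> and \<open>w\<close>, so that the case
      \<open>w a < v a\<close> follows by exchanging them.\<close>
    have ext: "g v = g w"
      if hyps: "v permutes {1..n}" "w permutes {1..n}" "enclosed n v w" "enclosed n w v"
        "\<And>i. i < a \<Longrightarrow> v i = w i" "v a < w a" for v w
    proof -
      obtain u where u: "u permutes {1..n}" "adjacent_1324 n v u" "\<And>i. i \<le> a \<Longrightarrow> u i = w i"
        using adjacent_1324_extending_prefix[OF hyps] by blast
      have "enclosed n u v" "enclosed n v u"
        using enclosed_adjacent_1324 u hyps adjacent_1324_sym by blast+
      then have "enclosed n u w" "enclosed n w u"
        using hyps(3,4) enclosed_trans by blast+
      then have "g u = g w"
        by (intro step.IH u(1) u(3) hyps(2)) simp_all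
      then show ?thesis using g u hyps by metis
    qed
    consider "v a < w a" | "w a < v a" | "v a = w a" by linarith
    then show ?case
    proof cases
      case 1
      then show ?thesis using ext step.prems by blast
    next
      case 2
      have "g w = g v" by (rule ext) (use 2 step.prems in auto)
      then show ?thesis ..
    next
      case 3
      then show ?thesis using step.prems by (intro step.IH) (auto simp: less_Suc_eq)
    qed
  qed
  from this[of 0, OF _ _ assms(2-5)] show ?thesis by simp
qed

section \<open>Spanning the class functions by indicators of down-sets\<close>

text \<open>\<open>D\<close> is a down-set containing the support of \<open>g\<close>. Subtracting
  \<open>g w\<close> times the indicator of the down-set of a maximal \<open>w\<close> clears the
  class of \<open>w\<close>, and \<open>D\<close> without that class is again a down-set.\<close>

lemma class_function_in_percent_space:
  assumes "D \<subseteq> {\<sigma>. \<sigma> permutes {1..n}}"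
    and "\<And>v w. w \<in> D \<Longrightarrow> v permutes {1..n} \<Longrightarrow> enclosed n v w \<Longrightarrow> v \<in> D"
    and "\<And>v. v permutes {1..n} \<Longrightarrow> v \<notin> D \<Longrightarrow> g v = 0"
    and "\<And>v w. v permutes {1..n} \<Longrightarrow> w permutes {1..n} \<Longrightarrow> enclosed n v w \<Longrightarrow> enclosed n w v \<Longrightarrow>
      g v = g w"
  shows "immanant n (\<lambda>\<sigma>. of_int (sign \<sigma>) * g \<sigma>) \<in> percent_space n"
proof -
  have "finite D" using assms(1) finite_permutations[of "{1..n}"] finite_subset by blast
  then show ?thesis using assms
  proof (induction D arbitrary: g rule: finite_psubset_induct)
    case (psubset D)
    note down = psubset.prems(2) and vanish = psubset.prems(3) and const = psubset.prems(4)
    show ?case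
    proof (cases "D = {}")
      case True
      then have "immanant n (\<lambda>\<sigma>. of_int (sign \<sigma>) * g \<sigma>) = immanant n (\<lambda>\<sigma>. 0)"
        using vanish by (intro immanant_cong) simp
      also have "\<dots> = 0" by (simp add: immanant_eq_sum_single)
      finally show ?thesis by (simp add: percent_space_zero)
    next
      case False
      \<comment> \<open>\<open>enclosed\<close> is only a preorder; inclusion of the sets
        \<open>below w\<close> is a partial order, which yields a maximal element.\<close>
      define below where "below w = {v \<in> D. enclosed n v w}" for w
      obtain w where wD: "w \<in> D"
        and maximal: "\<And>v. v \<in> D \<Longrightarrow> below w \<subseteq> below v \<Longrightarrow> below w = below v"
        using finite_has_maximal[of "below ` D"] False psubset.hyps by auto
      have wmax: "enclosed n v w" if v: "v \<in> D" "enclosed n w v" for v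
      proof -
        have "below w \<subseteq> below v"
          unfolding below_def using enclosed_trans[OF _ v(2)] by blast
        then have "below w = below v" by (rule maximal[OF v(1)])
        moreover have "v \<in> below v" using v enclosed_refl by (simp add: below_def)
        ultimately have "v \<in> below w" by (simp only:)
        then show ?thesis by (simp add: below_def)
      qed
      have w: "w permutes {1..n}" using wD psubset.prems(1) by blast
      obtain lam mu where sk: "skew_shape n lam mu"
        and lies: "\<And>v. lies_in n v lam mu \<longleftrightarrow> enclosed n v w"
        using minimal_skew_shape[OF w] by blast
      define h where "h v = g v - (if enclosed n v w then g w else 0)" for v
      \<comment> \<open>Only the class of \<open>w\<close> is removed: further down \<open>g\<close>
        may differ from \<open>g w\<close>.\<close>
      define D' where "D' = D - {v. enclosed n v w \<and> enclosed n w v}"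
      have "immanant n (\<lambda>\<sigma>. of_int (sign \<sigma>) * h \<sigma>) \<in> percent_space n"
      proof (rule psubset.IH)
        show "D' \<subset> D" using wD enclosed_refl unfolding D'_def by blast
        show "D' \<subseteq> {\<sigma>. \<sigma> permutes {1..n}}" using psubset.prems(1) unfolding D'_def by blast
        show "v \<in> D'" if "u \<in> D'" "v permutes {1..n}" "enclosed n v u" for u v
        proof -
          have u: "u \<in> D" using that unfolding D'_def by simp
          \<comment> \<open>Otherwise \<open>u\<close> would lie above \<open>w\<close>, hence by
            maximality in the removed class.\<close>
          have "\<not> enclosed n w v"
          proof
            assume "enclosed n w v"
            then have "enclosed n w u" using that(3) enclosed_trans by blast
            then show False using wmax[OF u] that(1) unfolding D'_def by simp
          qed
          moreover have "v \<in> D" using u that(2,3) by (rule down)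
          ultimately show ?thesis unfolding D'_def by simp
        qed
        show "h v = 0" if v: "v permutes {1..n}" "v \<notin> D'" for v
        proof (cases "v \<in> D")
          case True
          then show ?thesis using v const[OF v(1) w] unfolding D'_def h_def by simp
        next
          case False
          \<comment> \<open>Outside the down-set \<open>D\<close>, \<open>v\<close> is not below
            \<open>w\<close> either, so both terms of \<open>h v\<close> vanish.\<close>
          then show ?thesis using v vanish down[OF wD v(1)] unfolding h_def by auto
        qed
        show "h u = h v"
          if "u permutes {1..n}" "v permutes {1..n}" "enclosed n u v" "enclosed n v u" for u v
          using that const[OF that] enclosed_trans[of n u v w] enclosed_trans[of n v u w]
          unfolding h_def by auto
      qed
      moreover have "cscale (g w) (percent_immanant n lam mu) \<in> percent_space n"
        by (intro percent_space_scale percent_immanant_in_percent_space sk)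
      moreover have "immanant n (\<lambda>\<sigma>. of_int (sign \<sigma>) * g \<sigma>) =
          immanant n (\<lambda>\<sigma>. of_int (sign \<sigma>) * h \<sigma>) + cscale (g w) (percent_immanant n lam mu)"
        unfolding percent_immanant_eq_immanant immanant_scale[symmetric] immanant_add[symmetric]
        by (rule immanant_cong) (simp add: h_def lies algebra_simps)
      ultimately show ?thesis by (simp only: percent_space_add)
    qed
  qed
qed

theorem theorem3p1:
  fixes n :: nat and f :: "(nat \<Rightarrow> nat) \<Rightarrow> complex"
  shows "immanant n f \<in> percent_space n \<longleftrightarrow>
    (\<forall>w w'. w permutes {1..n} \<longrightarrow> w' permutes {1..n} \<longrightarrow> adjacent_1324 n w w' \<longrightarrow> f w = - f w')"
proof
  assume "immanant n f \<in> percent_space n"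
  then show "\<forall>w w'. w permutes {1..n} \<longrightarrow> w' permutes {1..n} \<longrightarrow> adjacent_1324 n w w' \<longrightarrow> f w = - f w'"
    using percent_space_imp_antisymmetric[of "immanant n f" n] lookup_immanant by metis
next
  assume f: "\<forall>w w'. w permutes {1..n} \<longrightarrow> w' permutes {1..n} \<longrightarrow> adjacent_1324 n w w' \<longrightarrow> f w = - f w'"
  \<comment> \<open>The sign turns antisymmetry under adjacency into invariance; as it squares to 1,
    a second factor restores \<open>f\<close>.\<close>
  define g where "g \<sigma> = of_int (sign \<sigma>) * f \<sigma>" for \<sigma> :: "nat \<Rightarrow> nat"
  have "g v = g w" if "v permutes {1..n}" "w permutes {1..n}" "adjacent_1324 n v w" for v w
    using f that sign_adjacent_1324[OF that] by (simp add: g_def)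
  note const = constant_on_enclosed_classes[of n g, OF this]
  have "immanant n (\<lambda>\<sigma>. of_int (sign \<sigma>) * g \<sigma>) \<in> percent_space n"
    \<comment> \<open>\<open>D\<close> is the whole symmetric group, so closure and the support
      condition are trivial.\<close>
    by (rule class_function_in_percent_space[OF subset_refl _ _ const]) simp_all
  also have "(\<lambda>\<sigma>. of_int (sign \<sigma>) * g \<sigma>) = f"
    by (auto simp: g_def fun_eq_iff sign_def)
  finally show "immanant n f \<in> percent_space n" .
qed

end
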